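(* Let $\mathbf{m}$ be an $\mathbb{R}^n$-valued Gaussian random vector with density $\pi_{\mathbf{m}}=\mathcal{N}(\mathbf{m}_0,\mathbf{\Gamma}_{\mathbf{m}\mathbf{m}})$, where $\mathbf{\Gamma}_{\mathbf{m}\mathbf{m}}$ is symmetric positive definite. Suppose $\mathbf{F}:\mathbb{R}^n\to\mathbb{R}^d$ is differentiable and bounded, with Jacobian $\mathbf{J}(\mathbf{m})\in\mathbb{R}^{d\times n}$. Let $\mathbf{F}_0=\mathbb{E}[\mathbf{F}(\mathbf{m})]\in\mathbb{R}^d$ and let $\mathbf{\Gamma}_{\mathbf{F}\mathbf{m}}=\mathbb{E}\big[(\mathbf{F}(\mathbf{m})-\mathbf{F}_0)(\mathbf{m}-\mathbf{m}_0)^\top\big]\in\mathbb{R}^{d\times n}$ be the cross-covariance matrix. Then $$\mathbb{E}[\mathbf{J}(\mathbf{m})]=\mathbf{\Gamma}_{\mathbf{F}\mathbf{m}}\mathbf{\Gamma}_{\mathbf{m}\mathbf{m}}^{-1}.$$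
   Context: All expectations are with respect to the Gaussian density $\pi_{\mathbf{m}}$. The matrix $\mathbf{\Gamma}_{\mathbf{F}\mathbf{m}}\mathbf{\Gamma}_{\mathbf{m}\mathbf{m}}^{-1}$ is called the pure-BAE global linear model (BAE = Bayesian approximation error) of the parameter-to-observable map $\mathbf{F}$.
   Formalization: The Jacobian J(m) is additionally assumed integrable under the Gaussian density, so that E[J(m)] exists; this does not follow from F being differentiable and bounded, e.g. F(x) = sin(exp(x^4)) for n = d = 1. *)

theory Defs
  imports "HOL-Probability.Probability"
begin

definition symmetric_positive_definite :: "real^'n^'n \<Rightarrow> bool"
  where "symmetric_positive_definite A \<longleftrightarrow>
    transpose A = A \<and> (\<forall>v. v \<noteq> 0 \<longrightarrow> v \<bullet> (A *v v) > 0)"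

definition gaussian_density :: "real^'n \<Rightarrow> real^'n^'n \<Rightarrow> real^'n \<Rightarrow> real"
  where "gaussian_density \<mu> \<Gamma> x =
    exp (- (1/2) * ((x - \<mu>) \<bullet> (matrix_inv \<Gamma> *v (x - \<mu>)))) /
    sqrt ((2 * pi) ^ CARD('n) * det \<Gamma>)"

definition outer_product :: "real^'d \<Rightarrow> real^'n \<Rightarrow> real^'n^'d"
  where "outer_product a b = (columnvector a :: real^1^'d) ** rowvector b"

end

theory Submission
  imports Defs
begin

text \<open>
  The identity is Stein's lemma for the Gaussian density \<open>\<rho>\<close>, read off entry by entry.
  With \<open>P = \<Gamma>\<^sup>-\<^sup>1\<close>, the derivative of \<open>\<rho>\<close> in direction \<open>v\<close> is
  \<open>- (v \<bullet> P (x - \<mu>)) \<rho> x\<close>, so for a bounded \<open>g\<close> with integrable derivative, integration by parts turns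
  \<open>E[\<partial>\<^sub>v g]\<close> into \<open>E[g(X) (v \<bullet> P (X - \<mu>))]\<close> (\<open>gaussian_stein_identity\<close>).
  For \<open>v\<close> the \<open>j\<close>-th coordinate vector and \<open>g\<close> the \<open>i\<close>-th component of \<open>F - F0\<close>, the left side is
  the \<open>(i, j)\<close> entry of the expected Jacobian, and by symmetry of \<open>P\<close> the right side is the
  \<open>(i, j)\<close> entry of \<open>E[(F - F0) (X - \<mu>)\<^sup>T] P\<close>.

  Since \<open>F\<close> is only differentiable, its derivative need not be continuous, and integration by parts
  rests on the fact that the directional derivative \<open>h'\<close> of a function \<open>h\<close> has integral zero as soon as
  \<open>h\<close> and \<open>h'\<close> are integrable (\<open>integral_directional_derivative_eq_0\<close>). Along almost every line
  parallel to \<open>v\<close>, the fundamental theorem of calculus gives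
  \<open>h (x + v) - h x = \<integral> h' (x + s v) ds\<close> over \<open>0 \<le> s \<le> 1\<close>. Integrating over \<open>x\<close>, the
  left side vanishes by translation invariance, and the right side is \<open>\<integral> h'\<close> by Fubini and
  translation invariance again.

  The remaining analytic input is that \<open>(v \<bullet> P (x - \<mu>)) \<rho> x\<close> is integrable. This also follows from
  translation invariance: translating \<open>\<rho>\<close> by \<open>\<plusminus>v\<close> multiplies it by
  \<open>exp (\<mp> v \<bullet> P (x - \<mu>))\<close> up to a constant, and \<open>\<bar>a\<bar> \<le> exp a + exp (- a)\<close>.
\<close>

section \<open>Integrals of directional derivatives\<close>

lemma integrable_translate_lborel:
  fixes f :: "'a::euclidean_space \<Rightarrow> real"
  assumes "integrable lborel f"
  shows "integrable lborel (\<lambda>x. f (x + v))"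
    and "(\<integral>x. f (x + v) \<partial>lborel) = (\<integral>x. f x \<partial>lborel)"
proof -
  have meas: "f \<in> borel_measurable borel"
    using borel_measurable_integrable[OF assms] by simp
  have "integrable (distr lborel borel ((+) v)) f"
    using assms by (simp add: lborel_distr_plus)
  then show "integrable lborel (\<lambda>x. f (x + v))"
    by (subst (asm) integrable_distr_eq) (auto simp: meas add.commute)
  have "(\<integral>x. f x \<partial>lborel) = integral\<^sup>L (distr lborel borel ((+) v)) f"
    by (simp add: lborel_distr_plus)
  also have "\<dots> = (\<integral>x. f (x + v) \<partial>lborel)"
    by (subst integral_distr) (auto simp: meas add.commute)
  finally show "(\<integral>x. f (x + v) \<partial>lborel) = (\<integral>x. f x \<partial>lborel)" by simp
qed

text \<open>
  The gauge integral satisfies the fundamental theorem of calculus for every derivative, continuous or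
  not; where the Lebesgue integral exists as well, the two agree.
\<close>

lemma integral_derivative_unit_segment:
  fixes f f' :: "real \<Rightarrow> real"
  assumes deriv: "\<And>s. (f has_real_derivative f' s) (at s)"
    and int: "integrable lborel (\<lambda>s. indicator {0..1} s * f' s)"
  shows "(\<integral>s. indicator {0..1} s * f' s \<partial>lborel) = f 1 - f 0"
proof -
  have "(f' has_integral (f 1 - f 0)) {0..1}"
    by (rule fundamental_theorem_of_calculus)
      (auto simp flip: has_real_derivative_iff_has_vector_derivative
        intro: has_field_derivative_at_within deriv)
  then have "((\<lambda>s. indicator {0..1} s * f' s) has_integral (f 1 - f 0)) UNIV"
    by (subst (asm) has_integral_restrict_UNIV[symmetric])
      (simp add: indicator_def of_bool_def if_distrib[of "\<lambda>c. c * _"] cong: if_cong)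
  with has_integral_integral_lborel[OF int] show ?thesis
    by (rule has_integral_unique)
qed

text \<open>
  Averaging \<open>h (x + v) - h x\<close> over all \<open>x\<close> gives zero by translation invariance; by Fubini it also
  gives the integral of \<open>h'\<close>.
\<close>

lemma integral_directional_derivative_eq_0:
  fixes h h' :: "'a::euclidean_space \<Rightarrow> real"
  assumes deriv: "\<And>x. ((\<lambda>t. h (x + t *\<^sub>R v)) has_real_derivative h' x) (at 0)"
    and int: "integrable lborel h" and int': "integrable lborel h'"
  shows "(\<integral>x. h' x \<partial>lborel) = 0"
proof -
  have [measurable]: "h' \<in> borel_measurable borel"
    using borel_measurable_integrable[OF int'] by simp
  define f where "f = (\<lambda>s x. indicator {0..1::real} s * h' (x + s *\<^sub>R v))"
  have f_int: "integrable (lborel \<Otimes>\<^sub>M lborel) (case_prod f)"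
  proof (rule lborel_pair.Fubini_integrable)
    show "case_prod f \<in> borel_measurable (lborel \<Otimes>\<^sub>M lborel)"
      unfolding f_def by measurable
    have "(\<integral>y. norm (case_prod f (s, y)) \<partial>lborel)
        = indicator {0..1} s * (\<integral>x. \<bar>h' x\<bar> \<partial>lborel)" for s
      using integrable_translate_lborel(2)[of "\<lambda>x. \<bar>h' x\<bar>" "s *\<^sub>R v"] int'
      by (simp add: f_def abs_mult)
    then show "integrable lborel (\<lambda>s. \<integral>y. norm (case_prod f (s, y)) \<partial>lborel)"
      by simp
    show "AE s in lborel. integrable lborel (\<lambda>y. case_prod f (s, y))"
      by (simp add: f_def integrable_translate_lborel[OF int'])
  qed
  have along_line: "((\<lambda>t. h (x + t *\<^sub>R v)) has_real_derivative h' (x + s *\<^sub>R v)) (at s)" for x s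
  proof -
    have "((\<lambda>t. h (x + t *\<^sub>R v)) has_real_derivative h' (x + s *\<^sub>R v)) (at (0 + s))"
      by (subst DERIV_shift)
        (use deriv[of "x + s *\<^sub>R v"] in \<open>simp add: algebra_simps\<close>)
    then show ?thesis by simp
  qed
  \<comment> \<open>The derivative may fail to be Lebesgue integrable on individual lines, but by Fubini only for
    a null set of starting points.\<close>
  have "AE x in lborel. integrable lborel (\<lambda>s. f s x)"
    by (rule lborel_pair.AE_integrable_snd[OF f_int])
  then have segment: "AE x in lborel. (\<integral>s. f s x \<partial>lborel) = h (x + v) - h x"
  proof eventually_elim
    case (elim x)
    then show ?case
      using integral_derivative_unit_segment[OF along_line[of x]] by (simp add: f_def)
  qed
  have "(\<integral>x. h' x \<partial>lborel) = (\<integral>s. indicator {0..1} s * (\<integral>x. h' x \<partial>lborel) \<partial>(lborel :: real measure))"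
    by simp
  also have "\<dots> = (\<integral>s. (\<integral>x. f s x \<partial>lborel) \<partial>lborel)"
    by (simp add: f_def integrable_translate_lborel[OF int'])
  also have "\<dots> = (\<integral>x. (\<integral>s. f s x \<partial>lborel) \<partial>lborel)"
    using lborel_pair.Fubini_integral[OF f_int] by simp
  also have "\<dots> = (\<integral>x. h (x + v) - h x \<partial>lborel)"
  proof (rule integral_cong_AE)
    show "(\<lambda>x. \<integral>s. f s x \<partial>lborel) \<in> borel_measurable lborel"
      using lborel_pair.integrable_snd[OF f_int] by (rule borel_measurable_integrable)
    show "(\<lambda>x. h (x + v) - h x) \<in> borel_measurable lborel"
      by (intro borel_measurable_diff borel_measurable_integrable
          integrable_translate_lborel int)
  qed (rule segment)
  also have "\<dots> = 0"
    by (simp add: integrable_translate_lborel[OF int] int)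
  finally show ?thesis .
qed

section \<open>The Gaussian density and its derivatives\<close>

lemma symmetric_positive_definite_inverse:
  fixes A :: "real^'n^'n"
  assumes "symmetric_positive_definite A"
  shows "A ** matrix_inv A = mat 1" and "matrix_inv A ** A = mat 1"
proof -
  have "v = 0" if "A *v v = 0" for v
    using assms that unfolding symmetric_positive_definite_def
    by (metis inner_zero_right less_irrefl)
  then have "invertible A"
    using matrix_left_invertible_ker[of A] invertible_left_inverse[of A] by blast
  then have "A ** matrix_inv A = mat 1 \<and> matrix_inv A ** A = mat 1"
    unfolding invertible_def matrix_inv_def by (rule someI_ex)
  then show "A ** matrix_inv A = mat 1" and "matrix_inv A ** A = mat 1" by auto
qed

lemma inner_matrix_inv_commute:
  fixes A :: "real^'n^'n"
  assumes "symmetric_positive_definite A"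
  shows "u \<bullet> (matrix_inv A *v w) = w \<bullet> (matrix_inv A *v u)"
proof -
  let ?P = "matrix_inv A"
  have cancel: "A *v (?P *v z) = z" for z
    by (simp add: matrix_vector_mul_assoc symmetric_positive_definite_inverse[OF assms])
  have sym: "transpose A = A"
    using assms by (simp add: symmetric_positive_definite_def)
  have "u \<bullet> (?P *v w) = (A *v (?P *v u)) \<bullet> (?P *v w)"
    by (simp add: cancel)
  also have "\<dots> = (?P *v u) \<bullet> (A *v (?P *v w))"
    using dot_lmul_matrix[of "?P *v u" A "?P *v w"] sym
    by (metis transpose_matrix_vector)
  finally show ?thesis by (simp add: cancel inner_commute)
qed

text \<open>
  Completing the square along a line: this one formula yields both the directional derivative of the
  density and, for \<open>t = \<plusminus>1\<close>, the integrability of that derivative.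
\<close>

lemma gaussian_density_shift:
  fixes \<mu> x v :: "real^'n"
  assumes "symmetric_positive_definite \<Gamma>"
  shows "gaussian_density \<mu> \<Gamma> (x + t *\<^sub>R v) = gaussian_density \<mu> \<Gamma> x *
    exp (- t * (v \<bullet> (matrix_inv \<Gamma> *v (x - \<mu>))) - t\<^sup>2 / 2 * (v \<bullet> (matrix_inv \<Gamma> *v v)))"
proof -
  let ?P = "matrix_inv \<Gamma>"
  have *: "x + t *\<^sub>R v - \<mu> = (x - \<mu>) + t *\<^sub>R v" by simp
  have "(x + t *\<^sub>R v - \<mu>) \<bullet> (?P *v (x + t *\<^sub>R v - \<mu>)) = (x - \<mu>) \<bullet> (?P *v (x - \<mu>))
      + 2 * t * (v \<bullet> (?P *v (x - \<mu>))) + t\<^sup>2 * (v \<bullet> (?P *v v))"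
    unfolding * matrix_vector_right_distrib inner_add_left inner_add_right
    using inner_matrix_inv_commute[OF assms, of "x - \<mu>" v]
    by (simp add: matrix_vector_mult_scaleR power2_eq_square)
  then show ?thesis
    by (simp add: gaussian_density_def exp_add[symmetric] algebra_simps)
qed

lemma gaussian_density_directional_derivative:
  fixes \<mu> x v :: "real^'n"
  assumes "symmetric_positive_definite \<Gamma>"
  shows "((\<lambda>t. gaussian_density \<mu> \<Gamma> (x + t *\<^sub>R v)) has_real_derivative
    - (v \<bullet> (matrix_inv \<Gamma> *v (x - \<mu>))) * gaussian_density \<mu> \<Gamma> x) (at 0)"
  unfolding gaussian_density_shift[OF assms]
  by (auto intro!: derivative_eq_intros)

lemma borel_measurable_affine [measurable]:
  fixes A :: "real^'n^'d"
  shows "(\<lambda>x. A *v (x - \<mu>)) \<in> borel_measurable borel"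
  by (intro borel_measurable_continuous_onI continuous_intros
      linear_continuous_on_compose[OF _ matrix_vector_mul_linear])

text \<open>
  The first moments of the density come from its exponential moments: the density times
  \<open>exp (\<plusminus> v \<bullet> P (x - \<mu>))\<close> is a multiple of a translate of the density, hence integrable.
\<close>

lemma integrable_gaussian_linear:
  fixes \<mu> v :: "real^'n"
  assumes spd: "symmetric_positive_definite \<Gamma>"
    and int: "integrable lborel (gaussian_density \<mu> \<Gamma>)"
  shows "integrable lborel (\<lambda>x. (v \<bullet> (matrix_inv \<Gamma> *v (x - \<mu>))) * gaussian_density \<mu> \<Gamma> x)"
proof -
  let ?\<rho> = "gaussian_density \<mu> \<Gamma>"
  let ?a = "\<lambda>x. v \<bullet> (matrix_inv \<Gamma> *v (x - \<mu>))"
  define b where "b = v \<bullet> (matrix_inv \<Gamma> *v v)"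
  have shift: "?\<rho> x * exp (- ?a x) = exp (b / 2) * ?\<rho> (x + v)"
    "?\<rho> x * exp (?a x) = exp (b / 2) * ?\<rho> (x + - v)" for x
    using gaussian_density_shift[OF spd, of \<mu> x 1 v] gaussian_density_shift[OF spd, of \<mu> x "-1" v]
    by (simp_all add: b_def exp_diff)
  show ?thesis
  proof (rule Bochner_Integration.integrable_bound)
    show "integrable lborel (\<lambda>x. exp (b / 2) * \<bar>?\<rho> (x + v)\<bar> + exp (b / 2) * \<bar>?\<rho> (x + - v)\<bar>)"
      by (intro Bochner_Integration.integrable_add integrable_mult_right integrable_abs
          integrable_translate_lborel int)
    show "(\<lambda>x. ?a x * ?\<rho> x) \<in> borel_measurable lborel"
      using borel_measurable_integrable[OF int] by simp
    have "\<bar>?a x\<bar> \<le> exp (- ?a x) + exp (?a x)" for x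
      using exp_ge_add_one_self[of "?a x"] exp_ge_add_one_self[of "- ?a x"]
        exp_gt_zero[of "?a x"] exp_gt_zero[of "- ?a x"] by linarith
    then have "\<bar>?a x\<bar> * \<bar>?\<rho> x\<bar> \<le> (exp (- ?a x) + exp (?a x)) * \<bar>?\<rho> x\<bar>" for x
      by (rule mult_right_mono) simp
    also have "(exp (- ?a x) + exp (?a x)) * \<bar>?\<rho> x\<bar> =
        \<bar>?\<rho> x * exp (- ?a x)\<bar> + \<bar>?\<rho> x * exp (?a x)\<bar>" for x
      by (simp add: abs_mult algebra_simps)
    finally show "AE x in lborel. norm (?a x * ?\<rho> x) \<le>
        norm (exp (b / 2) * \<bar>?\<rho> (x + v)\<bar> + exp (b / 2) * \<bar>?\<rho> (x + - v)\<bar>)"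
      unfolding shift by (simp add: abs_mult)
  qed
qed

text \<open>
  A negative normalising constant would make the density nonpositive, so that \<open>ennreal\<close> would truncate
  it to zero; this contradicts total mass one.
\<close>

lemma distributed_gaussian_density:
  fixes \<mu> :: "real^'n"
  assumes "prob_space M"
    and dist: "distributed M lborel X (\<lambda>x. ennreal (gaussian_density \<mu> \<Gamma> x))"
  shows "0 \<le> gaussian_density \<mu> \<Gamma> x" and "integrable lborel (gaussian_density \<mu> \<Gamma>)"
proof -
  interpret prob_space M by fact
  let ?\<rho> = "gaussian_density \<mu> \<Gamma>"
  have total: "(\<integral>\<^sup>+x. ennreal (?\<rho> x) \<partial>lborel) = 1"
    using distributed_nn_integral[OF dist, of "\<lambda>_. 1"] by (simp add: emeasure_space_1)
  have nonneg: "0 \<le> ?\<rho> x" for x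
  proof (rule ccontr)
    define D where "D = sqrt ((2 * pi) ^ CARD('n) * det \<Gamma>)"
    have density: "?\<rho> y = exp (- (1/2) * ((y - \<mu>) \<bullet> (matrix_inv \<Gamma> *v (y - \<mu>)))) / D" for y
      by (simp only: gaussian_density_def D_def)
    assume "\<not> 0 \<le> ?\<rho> x"
    then have "D < 0"
      unfolding density by (simp add: zero_le_divide_iff)
    then have "?\<rho> y \<le> 0" for y
      unfolding density by (simp add: divide_le_0_iff)
    then have "(\<integral>\<^sup>+x. ennreal (?\<rho> x) \<partial>lborel) = 0"
      by (simp add: ennreal_neg)
    with total show False by simp
  qed
  then show "0 \<le> ?\<rho> x" .
  have "?\<rho> \<in> borel_measurable lborel"
    unfolding gaussian_density_def[abs_def] by simp
  then show "integrable lborel ?\<rho>"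
    using total nonneg by (intro integrableI_nonneg) auto
qed

section \<open>Stein's identity\<close>

text \<open>
  The product of \<open>g\<close> with the density is integrable, so its directional derivative integrates to zero; the
  product rule splits that derivative into the two sides.
\<close>

lemma gaussian_integration_by_parts:
  fixes \<mu> v :: "real^'n" and g g' :: "real^'n \<Rightarrow> real"
  assumes spd: "symmetric_positive_definite \<Gamma>"
    and int: "integrable lborel (gaussian_density \<mu> \<Gamma>)"
    and meas: "g \<in> borel_measurable borel" and bdd: "bounded (range g)"
    and deriv: "\<And>x. ((\<lambda>t. g (x + t *\<^sub>R v)) has_real_derivative g' x) (at 0)"
    and int': "integrable lborel (\<lambda>x. gaussian_density \<mu> \<Gamma> x * g' x)"
  shows "integrable lborel (\<lambda>x. gaussian_density \<mu> \<Gamma> x * (g x * (v \<bullet> (matrix_inv \<Gamma> *v (x - \<mu>)))))"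
    and "(\<integral>x. gaussian_density \<mu> \<Gamma> x * g' x \<partial>lborel) =
      (\<integral>x. gaussian_density \<mu> \<Gamma> x * (g x * (v \<bullet> (matrix_inv \<Gamma> *v (x - \<mu>)))) \<partial>lborel)"
proof -
  let ?\<rho> = "gaussian_density \<mu> \<Gamma>"
  let ?a = "\<lambda>x. v \<bullet> (matrix_inv \<Gamma> *v (x - \<mu>))"
  obtain B where B: "\<And>x. \<bar>g x\<bar> \<le> B"
    using bdd by (auto simp: bounded_iff)
  have bounded_times: "integrable lborel (\<lambda>x. g x * k x)" if k: "integrable lborel k"
    for k :: "real^'n \<Rightarrow> real"
  proof (rule Bochner_Integration.integrable_bound)
    show "integrable lborel (\<lambda>x. B * k x)" using k by simp
    show "(\<lambda>x. g x * k x) \<in> borel_measurable lborel"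
      using meas borel_measurable_integrable[OF k] by simp
    have "\<bar>g x\<bar> * \<bar>k x\<bar> \<le> \<bar>B\<bar> * \<bar>k x\<bar>" for x
      using B[of x] by (intro mult_right_mono) auto
    then show "AE x in lborel. norm (g x * k x) \<le> norm (B * k x)"
      by (simp add: abs_mult)
  qed
  show right: "integrable lborel (\<lambda>x. ?\<rho> x * (g x * ?a x))"
    using bounded_times[OF integrable_gaussian_linear[OF spd int, of v]]
    by (simp add: mult_ac)
  have "(\<integral>x. ?\<rho> x * g' x - ?\<rho> x * (g x * ?a x) \<partial>lborel) = 0"
  proof (rule integral_directional_derivative_eq_0)
    show "((\<lambda>t. g (x + t *\<^sub>R v) * ?\<rho> (x + t *\<^sub>R v)) has_real_derivative
        ?\<rho> x * g' x - ?\<rho> x * (g x * ?a x)) (at 0)" for x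
      by (rule derivative_eq_intros deriv gaussian_density_directional_derivative[OF spd])+
        (simp add: algebra_simps)
  qed (intro bounded_times int Bochner_Integration.integrable_diff int' right)+
  then show "(\<integral>x. ?\<rho> x * g' x \<partial>lborel) = (\<integral>x. ?\<rho> x * (g x * ?a x) \<partial>lborel)"
    using int' right by simp
qed

text \<open>A directional derivative is a pointwise limit of difference quotients along \<open>1 / (n + 1)\<close>.\<close>

lemma borel_measurable_directional_derivative:
  fixes g g' :: "'a::euclidean_space \<Rightarrow> real"
  assumes g: "g \<in> borel_measurable borel"
    and deriv: "\<And>x. ((\<lambda>t. g (x + t *\<^sub>R v)) has_real_derivative g' x) (at 0)"
  shows "g' \<in> borel_measurable borel"
proof (rule borel_measurable_LIMSEQ_real)
  let ?t = "\<lambda>n. inverse (real (Suc n))"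
  show "(\<lambda>n. (g (x + ?t n *\<^sub>R v) - g x) / ?t n) \<longlonglongrightarrow> g' x" for x
  proof -
    have "((\<lambda>t. (g (x + t *\<^sub>R v) - g x) / t) \<longlongrightarrow> g' x) (at 0)"
      using deriv[of x] by (simp add: DERIV_def)
    moreover have "filterlim ?t (at 0) sequentially"
      using LIMSEQ_inverse_real_of_nat by (simp add: filterlim_at)
    ultimately show ?thesis by (rule filterlim_compose)
  qed
  show "(\<lambda>x. (g (x + ?t n *\<^sub>R v) - g x) / ?t n) \<in> borel_measurable borel" for n
    using g by simp
qed

text \<open>
  Integrability of the right-hand side is part of the conclusion, because the entries of the
  cross-covariance are later shown to be integrable by a suitable choice of \<open>v\<close>.
\<close>

lemma gaussian_stein_identity:
  fixes \<mu> v :: "real^'n" and g g' :: "real^'n \<Rightarrow> real"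
  assumes "prob_space M" and spd: "symmetric_positive_definite \<Gamma>"
    and dist: "distributed M lborel X (\<lambda>x. ennreal (gaussian_density \<mu> \<Gamma> x))"
    and meas: "g \<in> borel_measurable borel" and bdd: "bounded (range g)"
    and deriv: "\<And>x. ((\<lambda>t. g (x + t *\<^sub>R v)) has_real_derivative g' x) (at 0)"
    and int': "integrable M (\<lambda>\<omega>. g' (X \<omega>))"
  shows "integrable M (\<lambda>\<omega>. g (X \<omega>) * (v \<bullet> (matrix_inv \<Gamma> *v (X \<omega> - \<mu>))))"
    and "(\<integral>\<omega>. g' (X \<omega>) \<partial>M) =
      (\<integral>\<omega>. g (X \<omega>) * (v \<bullet> (matrix_inv \<Gamma> *v (X \<omega> - \<mu>))) \<partial>M)"
proof -
  note density = distributed_gaussian_density[OF \<open>prob_space M\<close> dist]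
  have g': "g' \<in> borel_measurable lborel"
    using borel_measurable_directional_derivative[OF meas deriv] by simp
  have ga: "(\<lambda>x. g x * (v \<bullet> (matrix_inv \<Gamma> *v (x - \<mu>)))) \<in> borel_measurable lborel"
    using meas by simp
  have "integrable lborel (\<lambda>x. gaussian_density \<mu> \<Gamma> x * g' x)"
    using distributed_integrable[OF dist g'] density(1) int' by simp
  note parts = gaussian_integration_by_parts[OF spd density(2) meas bdd deriv this]
  show "integrable M (\<lambda>\<omega>. g (X \<omega>) * (v \<bullet> (matrix_inv \<Gamma> *v (X \<omega> - \<mu>))))"
    using distributed_integrable[OF dist ga] density(1) parts(1) by simp
  show "(\<integral>\<omega>. g' (X \<omega>) \<partial>M) =
      (\<integral>\<omega>. g (X \<omega>) * (v \<bullet> (matrix_inv \<Gamma> *v (X \<omega> - \<mu>))) \<partial>M)"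
    using distributed_integral[OF dist g'] distributed_integral[OF dist ga] density(1) parts(2)
    by simp
qed

section \<open>Jacobian and cross-covariance\<close>

lemma jacobian_directional_derivative:
  fixes F :: "real^'n \<Rightarrow> real^'d"
  assumes "F differentiable (at x)"
  shows "((\<lambda>t. F (x + t *\<^sub>R v) $ i) has_real_derivative (jacobian F (at x) *v v) $ i) (at 0)"
proof -
  have "(F has_derivative (\<lambda>h. jacobian F (at x) *v h)) (at (x + 0 *\<^sub>R v))"
    using assms jacobian_works[of F "at x"] by simp
  moreover have "((\<lambda>t. x + t *\<^sub>R v) has_derivative (\<lambda>t. t *\<^sub>R v)) (at 0)"
    by (auto intro!: derivative_eq_intros)
  ultimately have "((\<lambda>t. F (x + t *\<^sub>R v)) has_derivative
      (\<lambda>t. jacobian F (at x) *v (t *\<^sub>R v))) (at 0)"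
    by (rule has_derivative_compose[rotated])
  then have "((\<lambda>t. F (x + t *\<^sub>R v) $ i) has_derivative
      (\<lambda>t. (jacobian F (at x) *v (t *\<^sub>R v)) $ i)) (at 0)"
    by (rule bounded_linear.has_derivative[OF bounded_linear_vec_nth])
  moreover have "(\<lambda>t. (jacobian F (at x) *v (t *\<^sub>R v)) $ i) = (*) ((jacobian F (at x) *v v) $ i)"
    by (simp add: matrix_vector_mult_scaleR fun_eq_iff)
  ultimately show ?thesis
    by (simp add: has_field_derivative_def)
qed

lemma outer_product_component: "outer_product a b $ i $ j = a $ i * b $ j"
  by (simp add: outer_product_def matrix_matrix_mult_def columnvector_def rowvector_def)

lemma integral_matrix_component:
  fixes A :: "'w \<Rightarrow> real^'n^'d"
  assumes "integrable M A"
  shows "(\<integral>\<omega>. A \<omega> \<partial>M) $ i $ j = (\<integral>\<omega>. A \<omega> $ i $ j \<partial>M)"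
    and "integrable M (\<lambda>\<omega>. A \<omega> $ i $ j)"
proof -
  have lin: "bounded_linear (\<lambda>A :: real^'n^'d. A $ i $ j)"
    by (rule bounded_linear_compose[OF bounded_linear_vec_nth bounded_linear_vec_nth])
  show "(\<integral>\<omega>. A \<omega> \<partial>M) $ i $ j = (\<integral>\<omega>. A \<omega> $ i $ j \<partial>M)"
    using integral_bounded_linear[OF lin assms] by simp
  show "integrable M (\<lambda>\<omega>. A \<omega> $ i $ j)"
    using integrable_bounded_linear[OF lin assms] .
qed

lemma integrable_vecI:
  fixes A :: "'w \<Rightarrow> 'a::euclidean_space^'n"
  assumes "\<And>i. integrable M (\<lambda>\<omega>. A \<omega> $ i)"
  shows "integrable M A"
proof -
  have "bounded_linear (axis i :: 'a \<Rightarrow> 'a^'n)" for i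
    by (intro linear_conv_bounded_linear[THEN iffD1] linearI) (simp_all add: vec_eq_iff axis_def)
  then have "integrable M (\<lambda>\<omega>. \<Sum>i\<in>UNIV. axis i (A \<omega> $ i))"
    by (intro Bochner_Integration.integrable_sum integrable_bounded_linear[OF _ assms])
  moreover have "(\<Sum>i\<in>UNIV. axis i (B $ i)) = B" for B :: "'a^'n"
    by (simp add: vec_eq_iff axis_def)
  ultimately show ?thesis by simp
qed

theorem theorem4p2:
  fixes M :: "'w measure"
    and m :: "'w \<Rightarrow> real^'n"
    and m0 :: "real^'n"
    and \<Gamma>mm :: "real^'n^'n"
    and F :: "real^'n \<Rightarrow> real^'d"
    and F0 :: "real^'d"
    and \<Gamma>Fm :: "real^'n^'d"
  assumes "prob_space M"
    and "symmetric_positive_definite \<Gamma>mm"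
    and "distributed M lborel m (\<lambda>x. ennreal (gaussian_density m0 \<Gamma>mm x))"
    and "\<forall>x. F differentiable (at x)"
    and "bounded (range F)"
    and "integrable M (\<lambda>\<omega>. jacobian F (at (m \<omega>)))"
    and "F0 = (\<integral>\<omega>. F (m \<omega>) \<partial>M)"
    and "\<Gamma>Fm = (\<integral>\<omega>. outer_product (F (m \<omega>) - F0) (m \<omega> - m0) \<partial>M)"
  shows "(\<integral>\<omega>. jacobian F (at (m \<omega>)) \<partial>M) = \<Gamma>Fm ** matrix_inv \<Gamma>mm"
proof -
  note spd = assms(2) and J_int = assms(6)
  let ?P = "matrix_inv \<Gamma>mm"
  let ?C = "\<lambda>\<omega>. outer_product (F (m \<omega>) - F0) (m \<omega> - m0)"
  define g where "g = (\<lambda>i x. F x $ i - F0 $ i)"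
  have "continuous_on UNIV F"
    using assms(4) by (meson continuous_at_imp_continuous_on differentiable_imp_continuous_within)
  then have g_meas: "g i \<in> borel_measurable borel" for i
    unfolding g_def by (intro borel_measurable_continuous_onI continuous_intros)
  obtain B where B: "\<And>x. norm (F x) \<le> B"
    using assms(5) by (auto simp: bounded_iff)
  have g_bdd: "bounded (range (g i))" for i
    unfolding bounded_iff
  proof (intro exI ballI, elim imageE, hypsubst)
    show "norm (g i x) \<le> B + norm F0" for x
      using B[of x] component_le_norm_cart[of "F x" i] component_le_norm_cart[of F0 i]
      by (simp add: g_def)
  qed
  have g_deriv: "((\<lambda>t. g i (x + t *\<^sub>R v)) has_real_derivative (jacobian F (at x) *v v) $ i) (at 0)"
    for i x v
    unfolding g_def
    using DERIV_diff[OF jacobian_directional_derivative DERIV_const, of F x v i "F0 $ i"] assms(4)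
    by simp
  have J_int_v: "integrable M (\<lambda>\<omega>. (jacobian F (at (m \<omega>)) *v v) $ i)" for i v
    unfolding matrix_vector_mult_def
    by (simp add: integral_matrix_component(2)[OF J_int])
  note stein = gaussian_stein_identity[OF assms(1) spd assms(3) g_meas g_bdd g_deriv J_int_v]
  have "v \<bullet> (?P *v w) = (?P *v v) \<bullet> w" for v w
    using inner_matrix_inv_commute[OF spd, of v w] by (simp add: inner_commute)
  note stein' = stein[unfolded this]
  \<comment> \<open>The direction \<open>v = \<Gamma> e\<^sub>k\<close> makes \<open>v \<bullet> P (x - m0)\<close> equal to the \<open>k\<close>-th coordinate of
    \<open>x - m0\<close>, so the integrability in Stein's identity is that of an entry of the cross-covariance.\<close>
  have C_int: "integrable M ?C"
  proof (intro integrable_vecI)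
    fix i k
    have "?P *v (\<Gamma>mm *v axis k 1) = axis k 1"
      by (simp add: matrix_vector_mul_assoc symmetric_positive_definite_inverse[OF spd])
    then show "integrable M (\<lambda>\<omega>. ?C \<omega> $ i $ k)"
      using stein'(1)[of i "\<Gamma>mm *v axis k 1"]
      by (simp add: g_def outer_product_component inner_axis' del: matrix_vector_mult_basis)
  qed
  have "(\<integral>\<omega>. jacobian F (at (m \<omega>)) \<partial>M) $ i $ j = (\<Gamma>Fm ** ?P) $ i $ j" for i j
  proof -
    have "(\<integral>\<omega>. jacobian F (at (m \<omega>)) \<partial>M) $ i $ j
        = (\<integral>\<omega>. (jacobian F (at (m \<omega>)) *v axis j 1) $ i \<partial>M)"
      by (simp add: integral_matrix_component[OF J_int] matrix_vector_mult_basis column_def)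
    also have "\<dots> = (\<integral>\<omega>. g i (m \<omega>) * (axis j 1 \<bullet> (?P *v (m \<omega> - m0))) \<partial>M)"
      by (rule stein(2))
    also have "\<dots> = (\<integral>\<omega>. (\<Sum>k\<in>UNIV. ?C \<omega> $ i $ k * ?P $ k $ j) \<partial>M)"
    proof (rule Bochner_Integration.integral_cong)
      fix \<omega>
      have "axis j 1 \<bullet> (?P *v (m \<omega> - m0)) = (\<Sum>k\<in>UNIV. (m \<omega> - m0) $ k * ?P $ k $ j)"
        unfolding inner_matrix_inv_commute[OF spd, of "axis j 1"]
        by (simp add: inner_vec_def matrix_vector_mult_basis column_def)
      then show "g i (m \<omega>) * (axis j 1 \<bullet> (?P *v (m \<omega> - m0))) = (\<Sum>k\<in>UNIV. ?C \<omega> $ i $ k * ?P $ k $ j)"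
        by (simp add: g_def outer_product_component sum_distrib_left mult.assoc)
    qed simp
    also have "\<dots> = (\<Sum>k\<in>UNIV. \<Gamma>Fm $ i $ k * ?P $ k $ j)"
      by (simp add: assms(8) integral_matrix_component[OF C_int])
    finally show ?thesis by (simp add: matrix_matrix_mult_def)
  qed
  then show ?thesis by (simp add: vec_eq_iff)
qed

end
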